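(* Let $y=(w,v_1,\dots,v_r,v'_1,\dots,v'_r)\in\mathcal N_r$ and let $Q\in\mathbb R^{(r+2nr)\times(r+(2n-1)r)}$ be a matrix whose columns form an orthonormal basis of $T_y\mathcal N_r$. Let $G^R=(g_0,g_1,\dots,g_r,g'_1,\dots,g'_r)\in\mathbb R^{r+2nr}$ (with $g_0\in\mathbb R^r$, $g_i,g_i'\in\mathbb R^n$) and $H^R\in\mathbb R^{(r+2nr)\times(r+2nr)}$ be respectively the gradient vector and the Hessian matrix of $f_R$ at $y$ in the canonical basis. Then the Riemannian gradient vector $G$ and the Riemannian Hessian matrix $H$ of $f$ at $y$ with respect to the basis $Q$ are given by $$G=Q^tG^R,\qquad H=Q^t(H^R+S)Q,$$ where $S=\mathrm{diag}(0_{r\times r},\tilde S,\tilde S)$ with $\tilde S=\mathrm{diag}(s_1I_n,\dots,s_rI_n)$ and $s_i=\langle v_i,g_i\rangle+\langle v'_i,g'_i\rangle$.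
   Context: $\mathbb C[\mathbf x]_d$ is the space of homogeneous polynomials of degree $d$ in $\mathbf x=(x_1,\dots,x_n)$. Writing $\mathbf p=\sum_{|\alpha|=d}\binom d\alpha p_\alpha\mathbf x^\alpha$, $\mathbf q=\sum_{|\alpha|=d}\binom d\alpha q_\alpha\mathbf x^\alpha$, the apolar product is $\langle\mathbf p,\mathbf q\rangle_d=\sum_{|\alpha|=d}\binom d\alpha\bar p_\alpha q_\alpha$ and $\|\mathbf p\|_d=\sqrt{\langle\mathbf p,\mathbf p\rangle_d}$. Standing assumptions: $d>2$ and $r<r_g$, where $r_g=\lceil\frac1n\binom{n+d-1}{d}\rceil$ is the generic symmetric rank, increased by $1$ for $(d,n)\in\{(3,5),(4,3),(4,4),(4,5)\}$. A polynomial $\mathbf p\in\mathbb C[\mathbf x]_d$ is fixed. $\mathcal N_r=\{(W,\Re V,\Im V): W\in(\mathbb R_+^* )^r,\ V=[v_i]\in\mathbb C^{n\times r},\ (\Re v_i,\Im v_i)\in\mathbb S^{2n-1}\ \forall i\}\subset\mathbb R^{r+2nr}$, where $\mathbb S^{2n-1}$ is the unit sphere of $\mathbb R^{2n}$, with the Riemannian metric induced by the Euclidean metric. For $y=(w,v_1,\dots,v_r,v'_1,\dots,v'_r)\in\mathcal N_r$ (here $v_i,v_i'\in\mathbb R^n$ are real and imaginary parts), $f(y)=\frac12\|\sum_{i=1}^rw_i((v_i+\mathbf i v'_i)^t\mathbf x)^d-\mathbf p\|_d^2$. The function $f_R$ is given by the same formula on the whole space $\mathcal R_r=\mathbb R^r\times\mathbb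 R^{n\times r}\times\mathbb R^{n\times r}\simeq\mathbb R^{r+2nr}$, with coordinates ordered as $(w,v_1,\dots,v_r,v'_1,\dots,v'_r)$. The angle brackets $\langle v_i,g_i\rangle$ denote the standard inner product on $\mathbb R^n$.
   Formalization: The sign of s_i is corrected to s_i = −(⟨v_i,g_i⟩+⟨v'_i,g'_i⟩); the printed plus sign fails for r=1, p=0, where f=w²/2 on N_1 has zero Hessian in sphere directions but the printed formula gives 2dw². Also r≥1 is assumed. *)

theory Defs
  imports "HOL-Analysis.Analysis" "HOL-Library.Poly_Mapping"
begin

section \<open>Homogeneous polynomials and the apolar product\<close>

text \<open>Polynomials in variables indexed by \<open>'n\<close>: a finitely supported map from exponent
  vectors to coefficients, multiplied by convolution.\<close>

type_synonym 'n cpoly = "('n \<Rightarrow>\<^sub>0 nat) \<Rightarrow>\<^sub>0 complex"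

definition exponents :: "nat \<Rightarrow> ('n::finite \<Rightarrow>\<^sub>0 nat) set" where
  "exponents d = {\<alpha>. (\<Sum>j\<in>UNIV. Poly_Mapping.lookup \<alpha> j) = d}"

definition homogeneous_polys :: "nat \<Rightarrow> 'n::finite cpoly set" where
  "homogeneous_polys d = {p. Poly_Mapping.keys p \<subseteq> exponents d}"

definition multinom :: "nat \<Rightarrow> ('n::finite \<Rightarrow>\<^sub>0 nat) \<Rightarrow> nat" where
  "multinom d \<alpha> = fact d div (\<Prod>j\<in>UNIV. fact (Poly_Mapping.lookup \<alpha> j))"

text \<open>The coefficient \<open>p\<^sub>\<alpha>\<close> in the scaled expansion
  \<open>p = (\<Sum>\<alpha>. multinom d \<alpha> * p\<^sub>\<alpha> * x ^ \<alpha>)\<close>.\<close>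

definition scaled_coeff :: "nat \<Rightarrow> 'n::finite cpoly \<Rightarrow> ('n \<Rightarrow>\<^sub>0 nat) \<Rightarrow> complex" where
  "scaled_coeff d p \<alpha> = Poly_Mapping.lookup p \<alpha> / of_nat (multinom d \<alpha>)"

definition apolar :: "nat \<Rightarrow> 'n::finite cpoly \<Rightarrow> 'n cpoly \<Rightarrow> complex" where
  "apolar d p q = (\<Sum>\<alpha>\<in>exponents d.
     of_nat (multinom d \<alpha>) * cnj (scaled_coeff d p \<alpha>) * scaled_coeff d q \<alpha>)"

definition apolar_norm :: "nat \<Rightarrow> 'n::finite cpoly \<Rightarrow> real" where
  "apolar_norm d p = sqrt (Re (apolar d p p))"

definition cvar :: "'n \<Rightarrow> 'n::finite cpoly" where
  "cvar j = Poly_Mapping.single (Poly_Mapping.single j 1) 1"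

definition cconst :: "complex \<Rightarrow> 'n::finite cpoly" where
  "cconst c = Poly_Mapping.single 0 c"

definition linear_form :: "complex ^ 'n \<Rightarrow> 'n::finite cpoly" where
  "linear_form v = (\<Sum>j\<in>UNIV. cconst (v $ j) * cvar j)"

definition generic_rank :: "nat \<Rightarrow> nat \<Rightarrow> nat" where
  "generic_rank d n =
     nat \<lceil>real ((n + d - 1) choose d) / real n\<rceil> +
     (if (d, n) \<in> {(3, 5), (4, 3), (4, 4), (4, 5)} then 1 else 0)"


section \<open>The parameter space and the objective function\<close>

text \<open>Coordinates \<open>(w, v\<^sub>1, \<dots>, v\<^sub>r, v'\<^sub>1, \<dots>, v'\<^sub>r)\<close>: the summands index in turn the weights, the
  real parts and the imaginary parts. Thus \<open>axis a 1\<close> runs through the canonical basis.\<close>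

type_synonym ('r, 'n) index = "'r + 'r \<times> 'n + 'r \<times> 'n"
type_synonym ('r, 'n) params = "real ^ ('r, 'n) index"

definition weight :: "('r::finite, 'n::finite) params \<Rightarrow> 'r \<Rightarrow> real" where
  "weight y i = y $ Inl i"

definition re_part :: "('r::finite, 'n::finite) params \<Rightarrow> 'r \<Rightarrow> real ^ 'n" where
  "re_part y i = (\<chi> j. y $ Inr (Inl (i, j)))"

definition im_part :: "('r::finite, 'n::finite) params \<Rightarrow> 'r \<Rightarrow> real ^ 'n" where
  "im_part y i = (\<chi> j. y $ Inr (Inr (i, j)))"

text \<open>The norm on a product type is the Euclidean one, so \<open>sphere 0 1\<close> below is the unit sphere
  of \<open>\<real>\<^sup>2\<^sup>n\<close>.\<close>

definition Nr :: "('r::finite, 'n::finite) params set" where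
  "Nr = {y. \<forall>i. weight y i > 0 \<and> (re_part y i, im_part y i) \<in> sphere 0 1}"

definition cvec :: "real ^ 'n::finite \<Rightarrow> real ^ 'n \<Rightarrow> complex ^ 'n" where
  "cvec v v' = (\<chi> j. Complex (v $ j) (v' $ j))"

definition objective :: "nat \<Rightarrow> 'n::finite cpoly \<Rightarrow> ('r::finite, 'n) params \<Rightarrow> real" where
  "objective d p y = 1/2 * (apolar_norm d
     ((\<Sum>i\<in>UNIV. cconst (of_real (weight y i)) *
         linear_form (cvec (re_part y i) (im_part y i)) ^ d) - p))\<^sup>2"


section \<open>Gradient and Hessian in the canonical basis\<close>

definition partial_deriv :: "'m \<Rightarrow> (real ^ 'm::finite \<Rightarrow> real) \<Rightarrow> real ^ 'm \<Rightarrow> real" where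
  "partial_deriv a f y = frechet_derivative f (at y) (axis a 1)"

definition gradient_vector :: "(real ^ 'm::finite \<Rightarrow> real) \<Rightarrow> real ^ 'm \<Rightarrow> real ^ 'm" where
  "gradient_vector f y = (\<chi> a. partial_deriv a f y)"

definition hessian_matrix :: "(real ^ 'm::finite \<Rightarrow> real) \<Rightarrow> real ^ 'm \<Rightarrow> real ^ 'm ^ 'm" where
  "hessian_matrix f y = (\<chi> a b. partial_deriv b (partial_deriv a f) y)"


section \<open>Riemannian geometry of an embedded submanifold of a Euclidean space\<close>

text \<open>\<open>M\<close> is an embedded submanifold of the Euclidean space \<open>'a\<close>, with the induced metric: the
  restriction of the inner product to each tangent space. All notions depend only on the values
  on \<open>M\<close> of the functions and vector fields involved.\<close>

primrec times_diff_on ::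
  "nat \<Rightarrow> 'a::euclidean_space set \<Rightarrow> ('a \<Rightarrow> 'b::euclidean_space) \<Rightarrow> bool" where
  "times_diff_on 0 U f = continuous_on U f"
| "times_diff_on (Suc k) U f =
     (f differentiable_on U \<and>
      (\<forall>u. times_diff_on k U (\<lambda>x. frechet_derivative f (at x) u)))"

text \<open>Smooth on \<open>M\<close>: restriction to \<open>M\<close> of a smooth function on an open neighbourhood of \<open>M\<close>.\<close>

definition smooth_on ::
  "'a::euclidean_space set \<Rightarrow> ('a \<Rightarrow> 'b::euclidean_space) \<Rightarrow> bool" where
  "smooth_on M f \<longleftrightarrow>
     (\<exists>U F. open U \<and> M \<subseteq> U \<and> (\<forall>k. times_diff_on k U F) \<and> (\<forall>x\<in>M. f x = F x))"

definition tangent_space :: "'a::euclidean_space set \<Rightarrow> 'a \<Rightarrow> 'a set" where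
  "tangent_space M y = {u. \<exists>c :: real \<Rightarrow> 'a. \<exists>e>0.
     smooth_on {-e<..<e} c \<and> c ` {-e<..<e} \<subseteq> M \<and> c 0 = y \<and>
     (c has_vector_derivative u) (at 0)}"

definition scalar_fields :: "'a::euclidean_space set \<Rightarrow> ('a \<Rightarrow> real) set" where
  "scalar_fields M = {h. smooth_on M h}"

definition vector_fields :: "'a::euclidean_space set \<Rightarrow> ('a \<Rightarrow> 'a) set" where
  "vector_fields M = {X. smooth_on M X \<and> (\<forall>y\<in>M. X y \<in> tangent_space M y)}"

text \<open>Derivative of \<open>h\<close> at \<open>y\<close> in the direction \<open>u\<close>. A derivative within \<open>M\<close> need not be unique as a
  linear map on \<open>'a\<close>, but its values on tangent vectors are, and only those are used.\<close>

definition deriv_along ::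
  "'a::euclidean_space set \<Rightarrow> ('a \<Rightarrow> 'b::euclidean_space) \<Rightarrow> 'a \<Rightarrow> 'a \<Rightarrow> 'b" where
  "deriv_along M h y u = frechet_derivative h (at y within M) u"

definition lie_bracket ::
  "'a::euclidean_space set \<Rightarrow> ('a \<Rightarrow> 'a) \<Rightarrow> ('a \<Rightarrow> 'a) \<Rightarrow> 'a \<Rightarrow> 'a" where
  "lie_bracket M X Y y = deriv_along M Y y (X y) - deriv_along M X y (Y y)"

definition affine_connection ::
  "'a::euclidean_space set \<Rightarrow> (('a \<Rightarrow> 'a) \<Rightarrow> ('a \<Rightarrow> 'a) \<Rightarrow> 'a \<Rightarrow> 'a) \<Rightarrow> bool" where
  "affine_connection M nabla \<longleftrightarrow>
     (\<forall>X\<in>vector_fields M. \<forall>Y\<in>vector_fields M. nabla X Y \<in> vector_fields M) \<and>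
     (\<forall>X\<in>vector_fields M. \<forall>X'\<in>vector_fields M. \<forall>Y\<in>vector_fields M.
        \<forall>h\<in>scalar_fields M. \<forall>h'\<in>scalar_fields M. \<forall>y\<in>M.
        nabla (\<lambda>z. h z *\<^sub>R X z + h' z *\<^sub>R X' z) Y y
          = h y *\<^sub>R nabla X Y y + h' y *\<^sub>R nabla X' Y y) \<and>
     (\<forall>X\<in>vector_fields M. \<forall>Y\<in>vector_fields M. \<forall>Y'\<in>vector_fields M. \<forall>y\<in>M.
        nabla X (\<lambda>z. Y z + Y' z) y = nabla X Y y + nabla X Y' y) \<and>
     (\<forall>X\<in>vector_fields M. \<forall>Y\<in>vector_fields M. \<forall>h\<in>scalar_fields M. \<forall>y\<in>M.
        nabla X (\<lambda>z. h z *\<^sub>R Y z) y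
          = deriv_along M h y (X y) *\<^sub>R Y y + h y *\<^sub>R nabla X Y y)"

definition levi_civita ::
  "'a::euclidean_space set \<Rightarrow> (('a \<Rightarrow> 'a) \<Rightarrow> ('a \<Rightarrow> 'a) \<Rightarrow> 'a \<Rightarrow> 'a) \<Rightarrow> bool" where
  "levi_civita M nabla \<longleftrightarrow> affine_connection M nabla \<and>
     (\<forall>X\<in>vector_fields M. \<forall>Y\<in>vector_fields M. \<forall>y\<in>M.
        nabla X Y y - nabla Y X y = lie_bracket M X Y y) \<and>
     (\<forall>X\<in>vector_fields M. \<forall>Y\<in>vector_fields M. \<forall>Z\<in>vector_fields M. \<forall>y\<in>M.
        deriv_along M (\<lambda>z. Y z \<bullet> Z z) y (X y) = nabla X Y y \<bullet> Z y + Y y \<bullet> nabla X Z y)"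

definition has_riemannian_gradient ::
  "'a::euclidean_space set \<Rightarrow> ('a \<Rightarrow> real) \<Rightarrow> 'a \<Rightarrow> 'a \<Rightarrow> bool" where
  "has_riemannian_gradient M f y g \<longleftrightarrow>
     f differentiable (at y within M) \<and> g \<in> tangent_space M y \<and>
     (\<forall>u\<in>tangent_space M y. g \<bullet> u = deriv_along M f y u)"

text \<open>\<open>A\<close> represents the endomorphism \<open>\<xi> \<mapsto> \<nabla>\<^sub>\<xi> grad f\<close> of the tangent space at \<open>y\<close>; its values
  outside the tangent space are irrelevant.\<close>

definition has_riemannian_hessian ::
  "'a::euclidean_space set \<Rightarrow> ('a \<Rightarrow> real) \<Rightarrow> 'a \<Rightarrow> ('a \<Rightarrow> 'a) \<Rightarrow> bool" where
  "has_riemannian_hessian M f y A \<longleftrightarrow>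
     (\<exists>nabla. \<exists>grad\<in>vector_fields M. levi_civita M nabla \<and>
        (\<forall>z\<in>M. has_riemannian_gradient M f z (grad z)) \<and>
        (\<forall>X\<in>vector_fields M. A (X y) = nabla X grad y))"

definition orthonormal_basis_columns :: "real ^ 'k::finite ^ 'm::finite \<Rightarrow> (real ^ 'm) set \<Rightarrow> bool" where
  "orthonormal_basis_columns Q T \<longleftrightarrow>
     (\<forall>k l. column k Q \<bullet> column l Q = (if k = l then 1 else 0)) \<and> span (columns Q) = T"

definition riemannian_gradient_wrt ::
  "(real ^ 'm::finite) set \<Rightarrow> (real ^ 'm \<Rightarrow> real) \<Rightarrow> real ^ 'm \<Rightarrow> real ^ 'k::finite ^ 'm \<Rightarrow>
   real ^ 'k \<Rightarrow> bool" where
  "riemannian_gradient_wrt M f y Q G \<longleftrightarrow> has_riemannian_gradient M f y (Q *v G)"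

definition riemannian_hessian_wrt ::
  "(real ^ 'm::finite) set \<Rightarrow> (real ^ 'm \<Rightarrow> real) \<Rightarrow> real ^ 'm \<Rightarrow> real ^ 'k::finite ^ 'm \<Rightarrow>
   real ^ 'k ^ 'k \<Rightarrow> bool" where
  "riemannian_hessian_wrt M f y Q H \<longleftrightarrow>
     (\<exists>A. has_riemannian_hessian M f y A \<and> (\<forall>x. A (Q *v x) = Q *v (H *v x)))"


section \<open>The correction matrix\<close>

text \<open>The sign in \<open>shift\<close> comes from the Weingarten map of the unit sphere: for \<open>x\<close> on the sphere and
  \<open>u\<close> tangent at \<open>x\<close>, the Hessian of the restriction of \<open>F\<close> sends \<open>u\<close> to the tangential part of
  \<open>D\<^sup>2F(x)u - (x \<bullet> \<nabla>F(x)) u\<close>. The source prints \<open>s\<^sub>i\<close> without the minus sign, which is a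
  misprint: for \<open>r = 1\<close> and \<open>p = 0\<close> the objective is \<open>w\<^sup>2/2\<close> on the manifold, so its Hessian vanishes
  in the sphere directions, whereas the ambient Hessian there is \<open>d w\<^sup>2\<close> times the identity and
  \<open>v \<bullet> g + v' \<bullet> g' = d w\<^sup>2\<close>.\<close>

definition shift :: "('r::finite, 'n::finite) params \<Rightarrow> ('r, 'n) params \<Rightarrow> 'r \<Rightarrow> real" where
  "shift y g i = - (re_part y i \<bullet> re_part g i + im_part y i \<bullet> im_part g i)"

definition correction :: "('r::finite \<Rightarrow> real) \<Rightarrow> real ^ ('r, 'n::finite) index ^ ('r, 'n) index" where
  "correction s = (\<chi> a b. if a \<noteq> b then 0 else
     (case a of Inl i \<Rightarrow> 0 | Inr (Inl (i, j)) \<Rightarrow> s i | Inr (Inr (i, j)) \<Rightarrow> s i))"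

end

theory Submission
  imports Defs
begin

text \<open>Let \<open>P\<^sub>z\<close> be the orthogonal projection of the ambient space onto the tangent space of \<^const>\<open>Nr\<close> at \<open>z\<close>. The set
  \<^const>\<open>Nr\<close> is an open orthant of weights times a product of unit spheres, so \<open>P\<^sub>z\<close> subtracts from a vector its
  components along the position vectors of the spheres (\<open>tangent_space_Nr\<close>, \<open>sphere_proj\<close>); it is polynomial
  in \<open>z\<close>.

  For any such projection the Levi-Civita connection of the induced metric is \<open>\<nabla>\<^sub>X Y = P (D Y [X])\<close>, the
  projected ambient derivative (\<open>levi_civita_connection\<close>, \<open>levi_civita_unique\<close>). If \<open>g\<close> is the ambient gradient
  of a smooth extension of the function, the Riemannian gradient is therefore \<open>z \<mapsto> P\<^sub>z (g z)\<close> and the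
  Riemannian Hessian sends \<open>u\<close> to \<open>P\<^sub>y (D g [u] + (D P [u]) (g y))\<close> (\<open>has_riemannian_hessian_iff\<close>). The first
  term is the ambient Hessian. In the second, differentiating \<open>- (x\<^sub>i \<bullet> g\<^sub>i) x\<^sub>i\<close> for the position
  vector \<open>x\<^sub>i\<close> of the \<open>i\<close>-th sphere while \<open>g\<close> is fixed yields a normal vector, which \<open>P\<^sub>y\<close> kills, and
  \<open>- (x\<^sub>i \<bullet> g\<^sub>i) u\<^sub>i\<close>, the correction term (\<open>sphere_proj_shift\<close>).

  An orthonormal basis \<open>Q\<close> of the tangent space satisfies \<open>Q\<^sup>t Q = 1\<close> and \<open>Q Q\<^sup>t = P\<^sub>y\<close>
  (\<open>P_eq_mult_transpose\<close>), which converts both formulas into coordinates. The objective function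
  has the required smooth gradient because its value is a polynomial in the parameters
  (\<open>infinitely_diff_on_objective\<close>).\<close>

section \<open>Calculus of infinitely differentiable maps\<close>

definition infinitely_diff_on :: "'a::euclidean_space set \<Rightarrow> ('a \<Rightarrow> 'b::euclidean_space) \<Rightarrow> bool" where
  "infinitely_diff_on U f \<longleftrightarrow> (\<forall>k. times_diff_on k U f)"

lemma times_diff_on_subset: "times_diff_on k U f \<Longrightarrow> V \<subseteq> U \<Longrightarrow> times_diff_on k V f"
proof (induction k arbitrary: f)
  case 0
  then show ?case by (auto intro: continuous_on_subset)
next
  case (Suc k)
  then show ?case by (auto intro: differentiable_on_subset)
qed

lemma has_derivative_transform_open:
  assumes "open U" "x \<in> U" "\<And>z. z \<in> U \<Longrightarrow> f z = g z" "(g has_derivative g') (at x)"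
  shows "(f has_derivative g') (at x)"
  using has_derivative_transform_within_open[OF assms(4,1,2)] assms(3) by metis

text \<open>Iterated derivatives are formed with \<^const>\<open>frechet_derivative\<close> at interior points, so on an open set
  they see only the values of the function there. This is what permits replacing the derivative by an
  explicit formula in \<open>times_diff_on_SucI\<close>, the rule behind the closure properties below.\<close>

lemma times_diff_on_cong:
  assumes "open U" "\<And>x. x \<in> U \<Longrightarrow> f x = g x"
  shows "times_diff_on k U f \<longleftrightarrow> times_diff_on k U g"
  using assms(2)
proof (induction k arbitrary: f g)
  case 0
  then show ?case by (auto cong: continuous_on_cong)
next
  case (Suc k)
  have d: "(f has_derivative D) (at x) \<longleftrightarrow> (g has_derivative D) (at x)" if "x \<in> U" for D x
    using has_derivative_transform_open[OF assms(1) that] Suc.prems by metis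
  have "f differentiable_on U \<longleftrightarrow> g differentiable_on U"
    using d by (auto simp: differentiable_on_eq_differentiable_at[OF assms(1)] differentiable_def)
  moreover have "frechet_derivative f (at x) = frechet_derivative g (at x)" if "x \<in> U" for x
    using d[OF that] by (simp add: frechet_derivative_def)
  then have "times_diff_on k U (\<lambda>x. frechet_derivative f (at x) u)
      \<longleftrightarrow> times_diff_on k U (\<lambda>x. frechet_derivative g (at x) u)" for u
    by (intro Suc.IH) simp
  ultimately show ?case by simp
qed

lemma times_diff_on_SucI:
  assumes "open U" "\<And>x. x \<in> U \<Longrightarrow> (f has_derivative f' x) (at x)"
    "\<And>u. times_diff_on k U (\<lambda>x. f' x u)"
  shows "times_diff_on (Suc k) U f"
proof -
  have "f differentiable_on U"
    using assms by (auto simp: differentiable_on_eq_differentiable_at differentiable_def)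
  moreover have "frechet_derivative f (at x) = f' x" if "x \<in> U" for x
    using frechet_derivative_at[OF assms(2)[OF that]] by simp
  then have "times_diff_on k U (\<lambda>x. frechet_derivative f (at x) u)" for u
    using times_diff_on_cong[OF assms(1), of "\<lambda>x. frechet_derivative f (at x) u" "\<lambda>x. f' x u" k] assms(3)
    by simp
  ultimately show ?thesis by simp
qed

lemma times_diff_on_has_derivative:
  assumes "open U" "times_diff_on (Suc k) U f" "x \<in> U"
  shows "(f has_derivative frechet_derivative f (at x)) (at x)"
  using assms by (auto simp: differentiable_on_eq_differentiable_at frechet_derivative_works)

text \<open>Needed for the product rule, where a factor stays undifferentiated and must be lowered by one
  order of differentiability.\<close>

lemma times_diff_on_Suc_imp: "times_diff_on (Suc k) U f \<Longrightarrow> times_diff_on k U f"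
proof (induction k arbitrary: f)
  case 0
  then show ?case by (simp add: differentiable_imp_continuous_on)
qed simp

lemma times_diff_on_const: "times_diff_on k U (\<lambda>x. c)"
proof (induction k arbitrary: c)
  case (Suc k)
  then show ?case by simp
qed simp

lemma times_diff_on_add:
  assumes "open U"
  shows "times_diff_on k U f \<Longrightarrow> times_diff_on k U g \<Longrightarrow> times_diff_on k U (\<lambda>x. f x + g x)"
proof (induction k arbitrary: f g)
  case 0
  then show ?case by (auto intro: continuous_on_add)
next
  case (Suc k)
  show ?case
  proof (rule times_diff_on_SucI[OF assms])
    show "((\<lambda>x. f x + g x) has_derivative
        (\<lambda>u. frechet_derivative f (at x) u + frechet_derivative g (at x) u)) (at x)" if "x \<in> U" for x
      using Suc.prems that assms by (intro has_derivative_add times_diff_on_has_derivative)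
    show "times_diff_on k U (\<lambda>x. frechet_derivative f (at x) u + frechet_derivative g (at x) u)" for u
      using Suc.prems by (intro Suc.IH) auto
  qed
qed

lemma times_diff_on_bilinear:
  assumes "open U" and "bounded_bilinear m"
  shows "times_diff_on k U f \<Longrightarrow> times_diff_on k U g \<Longrightarrow> times_diff_on k U (\<lambda>x. m (f x) (g x))"
proof (induction k arbitrary: f g)
  case 0
  then show ?case using bounded_bilinear.continuous_on[OF assms(2)] by auto
next
  case (Suc k)
  show ?case
  proof (rule times_diff_on_SucI[OF assms(1)])
    show "((\<lambda>x. m (f x) (g x)) has_derivative
        (\<lambda>u. m (f x) (frechet_derivative g (at x) u) + m (frechet_derivative f (at x) u) (g x))) (at x)"
      if "x \<in> U" for x
      using Suc.prems that assms by (intro bounded_bilinear.FDERIV[OF assms(2)] times_diff_on_has_derivative)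
    show "times_diff_on k U (\<lambda>x. m (f x) (frechet_derivative g (at x) u)
          + m (frechet_derivative f (at x) u) (g x))" for u
      using Suc.prems Suc.prems[THEN times_diff_on_Suc_imp]
      by (intro times_diff_on_add[OF assms(1)] Suc.IH) (simp_all only: times_diff_on.simps)
  qed
qed

lemma times_diff_on_linear:
  assumes "open U" and "bounded_linear f"
  shows "times_diff_on k U f"
proof (cases k)
  case 0
  then show ?thesis using linear_continuous_on[OF assms(2)] by simp
next
  case (Suc j)
  show ?thesis unfolding Suc
    by (rule times_diff_on_SucI[OF assms(1) bounded_linear_imp_has_derivative[OF assms(2)]])
      (rule times_diff_on_const)
qed

lemma infinitely_diff_on_subset:
  "infinitely_diff_on U f \<Longrightarrow> V \<subseteq> U \<Longrightarrow> infinitely_diff_on V f"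
  by (auto simp: infinitely_diff_on_def intro: times_diff_on_subset)

lemma infinitely_diff_on_const: "infinitely_diff_on U (\<lambda>x. c)"
  by (simp add: infinitely_diff_on_def times_diff_on_const)

lemma infinitely_diff_on_linear: "open U \<Longrightarrow> bounded_linear f \<Longrightarrow> infinitely_diff_on U f"
  by (simp add: infinitely_diff_on_def times_diff_on_linear)

lemma infinitely_diff_on_add:
  "open U \<Longrightarrow> infinitely_diff_on U f \<Longrightarrow> infinitely_diff_on U g \<Longrightarrow> infinitely_diff_on U (\<lambda>x. f x + g x)"
  by (simp add: infinitely_diff_on_def times_diff_on_add)

lemma infinitely_diff_on_bilinear:
  "open U \<Longrightarrow> bounded_bilinear m \<Longrightarrow> infinitely_diff_on U f \<Longrightarrow> infinitely_diff_on U g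
    \<Longrightarrow> infinitely_diff_on U (\<lambda>x. m (f x) (g x))"
  by (simp add: infinitely_diff_on_def times_diff_on_bilinear)

lemmas infinitely_diff_on_scaleR = infinitely_diff_on_bilinear[OF _ bounded_bilinear_scaleR]
lemmas infinitely_diff_on_mult = infinitely_diff_on_bilinear[OF _ bounded_bilinear_mult]
lemmas infinitely_diff_on_inner = infinitely_diff_on_bilinear[OF _ bounded_bilinear_inner]

lemma infinitely_diff_on_minus:
  assumes "open U" "infinitely_diff_on U f" shows "infinitely_diff_on U (\<lambda>x. - f x)"
  using infinitely_diff_on_scaleR[OF assms(1) infinitely_diff_on_const assms(2), of "-1"] by simp

lemma infinitely_diff_on_diff:
  "open U \<Longrightarrow> infinitely_diff_on U f \<Longrightarrow> infinitely_diff_on U g \<Longrightarrow> infinitely_diff_on U (\<lambda>x. f x - g x)"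
  using infinitely_diff_on_add[of U f "\<lambda>x. - g x"] infinitely_diff_on_minus by auto

lemma infinitely_diff_on_sum:
  assumes "open U" "\<And>i. i \<in> I \<Longrightarrow> infinitely_diff_on U (f i)"
  shows "infinitely_diff_on U (\<lambda>x. \<Sum>i\<in>I. f i x)"
  using assms(2)
  by (induction I rule: infinite_finite_induct)
    (auto intro: infinitely_diff_on_const infinitely_diff_on_add[OF assms(1)])

lemma infinitely_diff_on_has_derivative:
  "open U \<Longrightarrow> infinitely_diff_on U f \<Longrightarrow> x \<in> U \<Longrightarrow> (f has_derivative frechet_derivative f (at x)) (at x)"
  using times_diff_on_has_derivative infinitely_diff_on_def by blast

lemma infinitely_diff_on_derivative:
  "infinitely_diff_on U f \<Longrightarrow> infinitely_diff_on U (\<lambda>x. frechet_derivative f (at x) u)"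
  by (metis infinitely_diff_on_def times_diff_on.simps(2))

text \<open>Expanding the argument in the basis writes \<open>P z (F z)\<close> as a finite sum of products
  \<open>(F z \<bullet> b) *\<^sub>R P z b\<close>. So a family of linear maps needs smoothness for each fixed argument only, both
  when it is a derivative and when it is a projection onto varying tangent spaces.\<close>

lemma infinitely_diff_on_linear_family:
  fixes P :: "'a::euclidean_space \<Rightarrow> 'b::euclidean_space \<Rightarrow> 'c::euclidean_space"
  assumes "open U" "\<And>u. infinitely_diff_on U (\<lambda>z. P z u)" "\<And>z. z \<in> U \<Longrightarrow> linear (P z)"
    "infinitely_diff_on U F"
  shows "infinitely_diff_on U (\<lambda>z. P z (F z))"
proof -
  have "P z (F z) = (\<Sum>b\<in>Basis. (F z \<bullet> b) *\<^sub>R P z b)" if "z \<in> U" for z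
  proof -
    have "P z (F z) = P z (\<Sum>b\<in>Basis. (F z \<bullet> b) *\<^sub>R b)" by (simp add: euclidean_representation)
    then show ?thesis using assms(3)[OF that] by (simp add: linear_sum linear_cmul)
  qed
  moreover have "infinitely_diff_on U (\<lambda>z. \<Sum>b\<in>Basis. (F z \<bullet> b) *\<^sub>R P z b)"
    using assms by (intro infinitely_diff_on_sum infinitely_diff_on_scaleR infinitely_diff_on_inner
      infinitely_diff_on_const)
  ultimately show ?thesis
    using times_diff_on_cong[OF assms(1), of "\<lambda>z. P z (F z)" "\<lambda>z. \<Sum>b\<in>Basis. (F z \<bullet> b) *\<^sub>R P z b"]
    unfolding infinitely_diff_on_def by simp
qed

lemma has_derivative_linear_family:
  fixes P :: "'a::euclidean_space \<Rightarrow> 'b::euclidean_space \<Rightarrow> 'c::euclidean_space"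
  assumes "\<And>u. ((\<lambda>z. P z u) has_derivative P' u) (at y)" "\<And>z. linear (P z)"
    "(F has_derivative F') (at y)"
  shows "((\<lambda>z. P z (F z)) has_derivative (\<lambda>h. P' (F y) h + P y (F' h))) (at y)"
proof -
  have exp: "P z v = (\<Sum>b\<in>Basis. (v \<bullet> b) *\<^sub>R P z b)" for z v
  proof -
    have "P z v = P z (\<Sum>b\<in>Basis. (v \<bullet> b) *\<^sub>R b)" by (simp add: euclidean_representation)
    then show ?thesis using assms(2)[of z] by (simp add: linear_sum linear_cmul)
  qed
  have "((\<lambda>z. \<Sum>b\<in>Basis. (v \<bullet> b) *\<^sub>R P z b) has_derivative (\<lambda>h. \<Sum>b\<in>Basis. (v \<bullet> b) *\<^sub>R P' b h)) (at y)" for v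
    by (intro has_derivative_sum has_derivative_scaleR_right assms)
  then have exp': "P' v = (\<lambda>h. \<Sum>b\<in>Basis. (v \<bullet> b) *\<^sub>R P' b h)" for v
    using has_derivative_unique[OF assms(1)[of v]] exp[of _ v] by simp
  have "((\<lambda>z. \<Sum>b\<in>Basis. (F z \<bullet> b) *\<^sub>R P z b) has_derivative
      (\<lambda>h. \<Sum>b\<in>Basis. (F y \<bullet> b) *\<^sub>R P' b h + (F' h \<bullet> b) *\<^sub>R P y b)) (at y)"
    by (intro has_derivative_sum has_derivative_scaleR has_derivative_inner_left assms)
  then show ?thesis
    using exp[of _ "F _"] by (simp add: sum.distrib exp'[of "F y"] exp[of y "F' _"])
qed

section \<open>Differentiation along tangent vectors\<close>

lemma tangent_space_point:
  assumes "u \<in> tangent_space M y" shows "y \<in> M"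
  using assms by (force simp: tangent_space_def)

text \<open>A derivative within \<open>M\<close> is not unique, but composed with a curve in \<open>M\<close> it becomes an ordinary derivative
  in one real variable, which is. Hence any derivative computes \<^const>\<open>deriv_along\<close> on tangent vectors, and
  all identities for \<^const>\<open>deriv_along\<close> reduce to the usual derivative rules.\<close>

lemma deriv_along_eq:
  assumes "(h has_derivative D) (at y within M)" "u \<in> tangent_space M y"
  shows "deriv_along M h y u = D u"
proof -
  from assms(2) obtain c :: "real \<Rightarrow> 'a" and e where
    c: "e > 0" "c ` {-e<..<e} \<subseteq> M" "c 0 = y" "(c has_vector_derivative u) (at 0)"
    by (auto simp: tangent_space_def)
  have *: "((h \<circ> c) has_vector_derivative E u) (at 0)" if "(h has_derivative E) (at y within M)" for E
  proof -
    have c0: "(c has_derivative (\<lambda>t. t *\<^sub>R u)) (at 0 within {-e<..<e})"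
      using c(4) has_derivative_at_withinI by (auto simp: has_vector_derivative_def)
    have "((h \<circ> c) has_derivative (E \<circ> (\<lambda>t. t *\<^sub>R u))) (at 0 within {-e<..<e})"
      using c that by (intro diff_chain_within[OF c0]) (auto intro: has_derivative_subset)
    then have "((h \<circ> c) has_derivative (E \<circ> (\<lambda>t. t *\<^sub>R u))) (at 0)"
      using c(1) by (subst (asm) at_within_open) auto
    moreover have "linear E" using that has_derivative_linear by blast
    ultimately show ?thesis by (simp add: has_vector_derivative_def o_def linear_cmul)
  qed
  have "h differentiable (at y within M)" using assms(1) differentiable_def by blast
  then have "(h has_derivative frechet_derivative h (at y within M)) (at y within M)"
    by (simp add: frechet_derivative_works)
  then show ?thesis
    using *[OF assms(1)] * vector_derivative_unique_at unfolding deriv_along_def by blast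
qed

lemma smooth_onE:
  assumes "smooth_on M h"
  obtains U F where "open U" "M \<subseteq> U" "infinitely_diff_on U F" "\<And>x. x \<in> M \<Longrightarrow> h x = F x"
  using assms by (auto simp: smooth_on_def infinitely_diff_on_def)

lemma smooth_onI:
  "open U \<Longrightarrow> M \<subseteq> U \<Longrightarrow> infinitely_diff_on U F \<Longrightarrow> (\<And>x. x \<in> M \<Longrightarrow> h x = F x) \<Longrightarrow> smooth_on M h"
  by (auto simp: smooth_on_def infinitely_diff_on_def)

lemma has_derivative_restrict:
  assumes "(F has_derivative F') (at y)" "y \<in> M" "\<And>x. x \<in> M \<Longrightarrow> h x = F x"
  shows "(h has_derivative F') (at y within M)"
  using has_derivative_transform[of y M h F] assms has_derivative_at_withinI by blast

lemma smooth_on_deriv_along: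
  assumes "smooth_on M h" "y \<in> M"
  shows "(h has_derivative deriv_along M h y) (at y within M)"
proof -
  obtain U F where "open U" "M \<subseteq> U" "infinitely_diff_on U F" "\<And>x. x \<in> M \<Longrightarrow> h x = F x"
    using assms smooth_onE by metis
  then have "h differentiable (at y within M)"
    using has_derivative_restrict[OF infinitely_diff_on_has_derivative[of U F y]] assms(2)
    unfolding differentiable_def by blast
  then show ?thesis
    by (simp add: deriv_along_def[abs_def] frechet_derivative_works)
qed

section \<open>The Levi-Civita connection as a projected derivative\<close>

text \<open>A set \<open>M\<close> with orthogonal projections \<open>P y\<close> onto its tangent spaces that depend smoothly on \<open>y\<close>, also
  off \<open>M\<close>. For tangent \<open>u\<close> and \<open>v\<close>, the derivative of \<open>z \<mapsto> P z v\<close> in the direction \<open>u\<close> is the second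
  fundamental form of \<open>M\<close>. Its symmetry holds on every submanifold; it is an assumption here because for a
  concrete \<open>P\<close> it can be read off from the formula. It makes the projected derivative torsion-free.\<close>

locale tangential_projection =
  fixes M :: "'a::euclidean_space set" and P :: "'a \<Rightarrow> 'a \<Rightarrow> 'a"
  assumes smooth_P: "infinitely_diff_on UNIV (\<lambda>z. P z u)"
    and linear_P: "linear (P z)"
    and selfadjoint_P: "y \<in> M \<Longrightarrow> P y u \<bullet> v = u \<bullet> P y v"
    and P_tangent: "y \<in> M \<Longrightarrow> P y u \<in> tangent_space M y"
    and P_id: "u \<in> tangent_space M y \<Longrightarrow> P y u = u"
    and second_form_symmetric: "u \<in> tangent_space M y \<Longrightarrow> v \<in> tangent_space M y \<Longrightarrow>
      frechet_derivative (\<lambda>z. P z v) (at y) u = frechet_derivative (\<lambda>z. P z u) (at y) v"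
begin

abbreviation dP :: "'a \<Rightarrow> 'a \<Rightarrow> 'a \<Rightarrow> 'a" where
  "dP y v u \<equiv> frechet_derivative (\<lambda>z. P z v) (at y) u"

definition connection :: "('a \<Rightarrow> 'a) \<Rightarrow> ('a \<Rightarrow> 'a) \<Rightarrow> 'a \<Rightarrow> 'a" where
  "connection X Y y = P y (deriv_along M Y y (X y))"

lemma has_derivative_P: "((\<lambda>z. P z v) has_derivative dP y v) (at y)"
  by (rule infinitely_diff_on_has_derivative[OF open_UNIV smooth_P UNIV_I])

lemma vector_field_smooth: "X \<in> vector_fields M \<Longrightarrow> smooth_on M X"
  and vector_field_tangent: "X \<in> vector_fields M \<Longrightarrow> y \<in> M \<Longrightarrow> X y \<in> tangent_space M y"
  by (auto simp: vector_fields_def)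

lemma projected_field:
  assumes "smooth_on M F" shows "(\<lambda>z. P z (F z)) \<in> vector_fields M"
proof -
  obtain U F' where U: "open U" "M \<subseteq> U" "infinitely_diff_on U F'" "\<And>x. x \<in> M \<Longrightarrow> F x = F' x"
    using smooth_onE[OF assms] by metis
  have "infinitely_diff_on U (\<lambda>z. P z (F' z))"
    by (rule infinitely_diff_on_linear_family[OF U(1) infinitely_diff_on_subset[OF smooth_P subset_UNIV] linear_P U(3)])
  then have "smooth_on M (\<lambda>z. P z (F z))"
    using U by (intro smooth_onI[of U M]) auto
  then show ?thesis using P_tangent by (auto simp: vector_fields_def)
qed

lemma projected_const_field: "(\<lambda>z. P z u) \<in> vector_fields M"
  by (rule projected_field, rule smooth_onI[OF open_UNIV subset_UNIV infinitely_diff_on_const]) auto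

lemma smooth_on_derivative_of_field:
  assumes "X \<in> vector_fields M" "smooth_on M F"
  shows "smooth_on M (\<lambda>z. deriv_along M F z (X z))"
proof -
  obtain U X' where U: "open U" "M \<subseteq> U" "infinitely_diff_on U X'" "\<And>x. x \<in> M \<Longrightarrow> X x = X' x"
    using smooth_onE[OF vector_field_smooth[OF assms(1)]] by metis
  obtain V F' where V: "open V" "M \<subseteq> V" "infinitely_diff_on V F'" "\<And>x. x \<in> M \<Longrightarrow> F x = F' x"
    using smooth_onE[OF assms(2)] by metis
  define W where "W = U \<inter> V"
  have W: "open W" "M \<subseteq> W" "W \<subseteq> U" "W \<subseteq> V" using U V by (auto simp: W_def)
  have d: "(F' has_derivative frechet_derivative F' (at z)) (at z)" if "z \<in> W" for z
    using infinitely_diff_on_has_derivative[OF V(1,3)] that W by blast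
  have "infinitely_diff_on W (\<lambda>z. frechet_derivative F' (at z) (X' z))"
  proof (rule infinitely_diff_on_linear_family[where P = "\<lambda>z. frechet_derivative F' (at z)", OF W(1)])
    show "infinitely_diff_on W (\<lambda>z. frechet_derivative F' (at z) u)" for u
      by (rule infinitely_diff_on_subset[OF infinitely_diff_on_derivative[OF V(3)] W(4)])
    show "linear (frechet_derivative F' (at z))" if "z \<in> W" for z
      by (rule has_derivative_linear[OF d[OF that]])
    show "infinitely_diff_on W X'" using infinitely_diff_on_subset U W by blast
  qed
  moreover have "deriv_along M F z (X z) = frechet_derivative F' (at z) (X' z)" if "z \<in> M" for z
    using deriv_along_eq[OF has_derivative_restrict[OF d that V(4)] vector_field_tangent[OF assms(1) that]]
      that W U by auto
  ultimately show ?thesis by (rule smooth_onI[OF W(1,2)])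
qed

text \<open>The Gauss formula, obtained by differentiating \<open>Y z = P z (Y z)\<close> along \<open>M\<close>: the part of the derivative of
  a tangent field that the projection removes is the second fundamental form.\<close>

lemma normal_part_of_derivative:
  assumes "Y \<in> vector_fields M" "y \<in> M" "u \<in> tangent_space M y"
  shows "deriv_along M Y y u = dP y (Y y) u + P y (deriv_along M Y y u)"
proof -
  obtain U F where U: "open U" "M \<subseteq> U" "infinitely_diff_on U F" "\<And>x. x \<in> M \<Longrightarrow> Y x = F x"
    using smooth_onE[OF vector_field_smooth[OF assms(1)]] by metis
  define D where "D = frechet_derivative F (at y)"
  have D: "(F has_derivative D) (at y)"
    unfolding D_def using infinitely_diff_on_has_derivative[OF U(1,3)] U assms by blast
  have 1: "deriv_along M Y y u = D u"
    by (rule deriv_along_eq[OF has_derivative_restrict[OF D]]) (use U assms in auto)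
  have "Y z = P z (F z)" if "z \<in> M" for z
    using P_id[OF vector_field_tangent[OF assms(1) that]] U(4)[OF that] by simp
  then have "deriv_along M Y y u = dP y (F y) u + P y (D u)"
    by (intro deriv_along_eq[OF has_derivative_restrict[OF
          has_derivative_linear_family[of P, OF has_derivative_P linear_P D]]]) (use assms in auto)
  then show ?thesis using 1 U assms by simp
qed

text \<open>The algebraic rules and compatibility with the metric are the product rules for \<^const>\<open>deriv_along\<close>,
  projected. In \<open>deriv_along M Y y (X y) - deriv_along M X y (Y y)\<close> the normal parts cancel by symmetry of
  the second fundamental form, so the Lie bracket is already the difference of the projected derivatives.\<close>

lemma levi_civita_connection: "levi_civita M connection"
proof -
  have conn: "(h has_derivative deriv_along M h y) (at y within M)"
    if "h \<in> vector_fields M" "y \<in> M" for h y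
    using smooth_on_deriv_along that vector_field_smooth by blast
  have lin: "linear (deriv_along M h y)" if "h \<in> vector_fields M" "y \<in> M" for h y
    using conn[OF that] has_derivative_linear by blast
  have c1: "connection X Y \<in> vector_fields M" if "X \<in> vector_fields M" "Y \<in> vector_fields M" for X Y
    unfolding connection_def[abs_def]
    by (intro projected_field smooth_on_derivative_of_field that vector_field_smooth)
  have c2: "connection (\<lambda>z. h z *\<^sub>R X z + h' z *\<^sub>R X' z) Y y
      = h y *\<^sub>R connection X Y y + h' y *\<^sub>R connection X' Y y"
    if "Y \<in> vector_fields M" "y \<in> M" for X X' Y y h h'
    unfolding connection_def linear_add[OF lin[OF that]] linear_cmul[OF lin[OF that]]
      linear_add[OF linear_P] linear_cmul[OF linear_P] ..
  have c3: "connection X (\<lambda>z. Y z + Y' z) y = connection X Y y + connection X Y' y"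
    if that: "X \<in> vector_fields M" "Y \<in> vector_fields M" "Y' \<in> vector_fields M" "y \<in> M" for X Y Y' y
    unfolding connection_def linear_add[OF linear_P, symmetric]
    by (rule arg_cong[of _ _ "P y"],
      rule deriv_along_eq[OF has_derivative_add[OF conn[OF that(2,4)] conn[OF that(3,4)]]
        vector_field_tangent[OF that(1,4)]])
  have c4: "connection X (\<lambda>z. h z *\<^sub>R Y z) y
      = deriv_along M h y (X y) *\<^sub>R Y y + h y *\<^sub>R connection X Y y"
    if that: "X \<in> vector_fields M" "Y \<in> vector_fields M" "h \<in> scalar_fields M" "y \<in> M" for X Y h y
  proof -
    have h: "(h has_derivative deriv_along M h y) (at y within M)"
      using that smooth_on_deriv_along by (auto simp: scalar_fields_def)
    have "deriv_along M (\<lambda>z. h z *\<^sub>R Y z) y (X y)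
        = h y *\<^sub>R deriv_along M Y y (X y) + deriv_along M h y (X y) *\<^sub>R Y y"
      by (rule deriv_along_eq[OF has_derivative_scaleR[OF h conn[OF that(2,4)]]
        vector_field_tangent[OF that(1,4)]])
    then show ?thesis
      using P_id[OF vector_field_tangent[OF that(2,4)]]
      by (simp add: connection_def linear_add[OF linear_P] linear_cmul[OF linear_P])
  qed
  have c5: "connection X Y y - connection Y X y = lie_bracket M X Y y"
    if that: "X \<in> vector_fields M" "Y \<in> vector_fields M" "y \<in> M" for X Y y
  proof -
    have "deriv_along M Y y (X y) = dP y (Y y) (X y) + connection X Y y"
      "deriv_along M X y (Y y) = dP y (X y) (Y y) + connection Y X y"
      unfolding connection_def using that by (auto intro: normal_part_of_derivative vector_field_tangent)
    moreover have "dP y (Y y) (X y) = dP y (X y) (Y y)"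
      using that by (auto intro: second_form_symmetric vector_field_tangent)
    ultimately show ?thesis by (simp add: lie_bracket_def)
  qed
  have c6: "deriv_along M (\<lambda>z. Y z \<bullet> Z z) y (X y) = connection X Y y \<bullet> Z y + Y y \<bullet> connection X Z y"
    if that: "X \<in> vector_fields M" "Y \<in> vector_fields M" "Z \<in> vector_fields M" "y \<in> M" for X Y Z y
  proof -
    have "deriv_along M (\<lambda>z. Y z \<bullet> Z z) y (X y)
        = Y y \<bullet> deriv_along M Z y (X y) + deriv_along M Y y (X y) \<bullet> Z y"
      by (rule deriv_along_eq[OF has_derivative_inner[OF conn[OF that(2,4)] conn[OF that(3,4)]]
        vector_field_tangent[OF that(1,4)]])
    also have "Y y \<bullet> deriv_along M Z y (X y) = Y y \<bullet> connection X Z y"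
      unfolding connection_def selfadjoint_P[OF that(4), symmetric]
        P_id[OF vector_field_tangent[OF that(2,4)]] ..
    also have "deriv_along M Y y (X y) \<bullet> Z y = connection X Y y \<bullet> Z y"
      unfolding connection_def selfadjoint_P[OF that(4)] P_id[OF vector_field_tangent[OF that(3,4)]] ..
    finally show ?thesis by simp
  qed
  show ?thesis
    unfolding levi_civita_def affine_connection_def
    by (intro conjI ballI; (rule c1 c2 c3 c4 c5 c6; assumption))
qed

text \<open>The difference of two Levi-Civita connections, paired with a third field, is symmetric in its first
  two arguments (both have the same torsion) and antisymmetric in its last two (both are metric). Six
  alternating swaps return to the original order with the opposite sign, so it vanishes. Testing it
  against the two covariant derivatives themselves then shows that they agree.\<close>

lemma levi_civita_unique:
  assumes nabla: "levi_civita M nabla" and nabla': "levi_civita M nabla'"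
    and X: "X \<in> vector_fields M" and Y: "Y \<in> vector_fields M" and y: "y \<in> M"
  shows "nabla X Y y = nabla' X Y y"
proof -
  define E where "E X Y Z = (nabla X Y y - nabla' X Y y) \<bullet> Z y" for X Y Z
  have torsion: "N X Y y - N Y X y = lie_bracket M X Y y"
    if "levi_civita M N" "X \<in> vector_fields M" "Y \<in> vector_fields M" for N X Y
    using that y unfolding levi_civita_def by blast
  have metric: "deriv_along M (\<lambda>z. Y z \<bullet> Z z) y (X y) = N X Y y \<bullet> Z y + Y y \<bullet> N X Z y"
    if "levi_civita M N" "X \<in> vector_fields M" "Y \<in> vector_fields M" "Z \<in> vector_fields M" for N X Y Z
    using that y unfolding levi_civita_def by blast
  have sym: "E X Y Z = E Y X Z" if "X \<in> vector_fields M" "Y \<in> vector_fields M" for X Y Z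
  proof -
    have "nabla X Y y - nabla' X Y y = nabla Y X y - nabla' Y X y"
      using torsion[OF nabla that] torsion[OF nabla' that] by (simp add: algebra_simps)
    then show ?thesis by (simp only: E_def)
  qed
  have alt: "E X Y Z = - E X Z Y"
    if "X \<in> vector_fields M" "Y \<in> vector_fields M" "Z \<in> vector_fields M" for X Y Z
    using metric[OF nabla that] metric[OF nabla' that]
    by (simp add: E_def inner_diff_left inner_commute[of "Y y"])
  have 0: "E X Y Z = 0" if Z: "Z \<in> vector_fields M" for Z
    using sym[OF X Y, of Z] alt[OF Y X Z] sym[OF Y Z, of X] alt[OF Z Y X] sym[OF Z X, of Y] alt[OF X Z Y]
    by linarith
  have "N X Y \<in> vector_fields M" if "levi_civita M N" for N
  proof -
    have "\<forall>X\<in>vector_fields M. \<forall>Y\<in>vector_fields M. N X Y \<in> vector_fields M"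
      using that unfolding levi_civita_def affine_connection_def by (elim conjE)
    then show ?thesis using X Y by blast
  qed
  from this[OF nabla] this[OF nabla'] have "E X Y (nabla X Y) - E X Y (nabla' X Y) = 0" using 0 by simp
  then have "(nabla X Y y - nabla' X Y y) \<bullet> (nabla X Y y - nabla' X Y y) = 0"
    by (simp only: E_def inner_diff_right)
  then show ?thesis by simp
qed

text \<open>The Riesz representative, within the tangent space, of the functional \<open>u \<mapsto> g \<bullet> u\<close>. This is the form in
  which both Riemannian gradients and coordinate expressions for \<open>P\<close> are identified.\<close>

lemma P_eq_iff:
  assumes "y \<in> M"
  shows "v = P y g \<longleftrightarrow> v \<in> tangent_space M y \<and> (\<forall>u\<in>tangent_space M y. v \<bullet> u = g \<bullet> u)"
proof
  assume "v = P y g"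
  then show "v \<in> tangent_space M y \<and> (\<forall>u\<in>tangent_space M y. v \<bullet> u = g \<bullet> u)"
    using P_tangent P_id selfadjoint_P assms by simp
next
  assume v: "v \<in> tangent_space M y \<and> (\<forall>u\<in>tangent_space M y. v \<bullet> u = g \<bullet> u)"
  have "v \<bullet> w = P y g \<bullet> w" for w
  proof -
    have "v \<bullet> w = v \<bullet> P y w" using v P_id selfadjoint_P[OF assms, of v] by simp
    also have "\<dots> = g \<bullet> P y w" using v P_tangent assms by simp
    also have "\<dots> = P y g \<bullet> w" using selfadjoint_P assms by simp
    finally show ?thesis .
  qed
  then show "v = P y g" by (metis vector_eq_rdot)
qed

lemma has_riemannian_gradient_iff:
  assumes "(F has_derivative (\<lambda>u. g \<bullet> u)) (at y)" "y \<in> M" "\<And>z. z \<in> M \<Longrightarrow> f z = F z"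
  shows "has_riemannian_gradient M f y v \<longleftrightarrow> v = P y g"
proof -
  have d: "(f has_derivative (\<lambda>u. g \<bullet> u)) (at y within M)"
    using has_derivative_restrict assms by blast
  then have "f differentiable (at y within M)" by (auto simp: differentiable_def)
  then show ?thesis
    using deriv_along_eq[OF d] P_eq_iff[OF assms(2)] by (simp add: has_riemannian_gradient_def)
qed

text \<open>The Riemannian gradient is \<open>z \<mapsto> P z (g z)\<close>. Differentiating it gives a term in which \<open>P\<close> moves and a term in
  which \<open>g\<close> moves; projecting again leaves the projected ambient Hessian plus the Weingarten term
  \<open>P y (dP y (g y) u)\<close>. Uniqueness of the connection makes this a characterisation, and the fields
  \<open>z \<mapsto> P z u\<close> supply every tangent vector \<open>u\<close> as the value of a vector field.\<close>

lemma has_riemannian_hessian_iff: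
  assumes F: "\<And>z. (F has_derivative (\<lambda>u. g z \<bullet> u)) (at z)" and g: "infinitely_diff_on UNIV g"
    and g': "(g has_derivative g') (at y)" and y: "y \<in> M" and f: "\<And>z. z \<in> M \<Longrightarrow> f z = F z"
  shows "has_riemannian_hessian M f y A \<longleftrightarrow>
    (\<forall>u\<in>tangent_space M y. A u = P y (dP y (g y) u + g' u))"
proof -
  have grad: "has_riemannian_gradient M f z v \<longleftrightarrow> v = P z (g z)" if "z \<in> M" for z v
    using has_riemannian_gradient_iff[OF F that f] .
  have field: "(\<lambda>z. P z (g z)) \<in> vector_fields M"
    by (rule projected_field, rule smooth_onI[OF open_UNIV _ g]) auto
  have conn: "connection X G y = P y (dP y (g y) (X y) + P y (g' (X y)))"
    if "X \<in> vector_fields M" "\<And>z. z \<in> M \<Longrightarrow> G z = P z (g z)" for X G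
    using deriv_along_eq[OF has_derivative_restrict[OF
          has_derivative_linear_family[of P, OF has_derivative_P linear_P g'] y that(2)]
        vector_field_tangent[OF that(1) y]]
    by (simp add: connection_def)
  have eq: "P y (dP y (g y) u + P y (g' u)) = P y (dP y (g y) u + g' u)" for u
    using P_id[OF P_tangent[OF y]] linear_P[of y] by (simp add: linear_add)
  have X: "\<exists>X\<in>vector_fields M. X y = u" if "u \<in> tangent_space M y" for u
    using projected_const_field P_id that by metis
  show ?thesis
  proof
    assume "has_riemannian_hessian M f y A"
    then obtain nabla G where n: "levi_civita M nabla" "G \<in> vector_fields M"
      "\<And>z. z \<in> M \<Longrightarrow> has_riemannian_gradient M f z (G z)"
      "\<And>X. X \<in> vector_fields M \<Longrightarrow> A (X y) = nabla X G y"
      unfolding has_riemannian_hessian_def by blast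
    have "A (X y) = P y (dP y (g y) (X y) + g' (X y))" if "X \<in> vector_fields M" for X
      using n(4)[OF that] levi_civita_unique[OF n(1) levi_civita_connection that n(2) y]
        conn[OF that, of G] n(3) grad eq by auto
    then show "\<forall>u\<in>tangent_space M y. A u = P y (dP y (g y) u + g' u)" using X by metis
  next
    assume "\<forall>u\<in>tangent_space M y. A u = P y (dP y (g y) u + g' u)"
    then have "A (X y) = connection X (\<lambda>z. P z (g z)) y" if "X \<in> vector_fields M" for X
      using conn[OF that] vector_field_tangent[OF that y] eq by simp
    moreover have "\<forall>z\<in>M. has_riemannian_gradient M f z (P z (g z))" using grad by blast
    ultimately show "has_riemannian_hessian M f y A"
      unfolding has_riemannian_hessian_def
      by (intro exI[of _ connection] bexI[OF _ field] conjI ballI levi_civita_connection) auto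
  qed
qed

end

section \<open>The geometry of the product of spheres\<close>

lemma sum_UNIV_sum_type:
  fixes h :: "'c::finite + 'd::finite \<Rightarrow> 'b::comm_monoid_add"
  shows "sum h UNIV = (\<Sum>i\<in>UNIV. h (Inl i)) + (\<Sum>i\<in>UNIV. h (Inr i))"
  using sum.Plus[of UNIV UNIV h] by simp

lemma sum_index:
  fixes h :: "('r::finite, 'n::finite) index \<Rightarrow> 'b::comm_monoid_add"
  shows "(\<Sum>a\<in>UNIV. h a) = (\<Sum>i\<in>UNIV. h (Inl i)) +
    ((\<Sum>i\<in>UNIV. \<Sum>j\<in>UNIV. h (Inr (Inl (i, j)))) + (\<Sum>i\<in>UNIV. \<Sum>j\<in>UNIV. h (Inr (Inr (i, j)))))"
proof -
  have "sum g (UNIV :: ('r \<times> 'n) set) = (\<Sum>i\<in>UNIV. \<Sum>j\<in>UNIV. g (i, j))" for g :: "'r \<times> 'n \<Rightarrow> 'b"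
    by (simp add: sum.cartesian_product)
  then show ?thesis by (simp only: sum_UNIV_sum_type)
qed

text \<open>The part of a parameter vector that belongs to the pair \<open>(v\<^sub>i, v'\<^sub>i)\<close>, as a vector of the same space.
  The maps \<open>block i\<close> are mutually orthogonal projections, so sphere constraints and tangent spaces become
  statements about inner products in a single space.\<close>

definition block :: "'r \<Rightarrow> ('r::finite, 'n::finite) params \<Rightarrow> ('r, 'n) params" where
  "block i y = (\<chi> a. case a of Inl k \<Rightarrow> 0
     | Inr (Inl (k, j)) \<Rightarrow> if k = i then y $ a else 0 | Inr (Inr (k, j)) \<Rightarrow> if k = i then y $ a else 0)"

lemma linear_block: "linear (block i)"
  by (rule linearI) (auto simp: block_def vec_eq_iff split: sum.split)

lemmas bounded_linear_block = linear_block[THEN linear_conv_bounded_linear[THEN iffD1]]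

lemma block_block: "block i (block k u) = (if i = k then block i u else 0)"
  by (auto simp: block_def vec_eq_iff split: sum.split)

lemma block_inner: "block i u \<bullet> v = re_part u i \<bullet> re_part v i + im_part u i \<bullet> im_part v i"
proof -
  have *: "(\<Sum>k\<in>UNIV. \<Sum>j\<in>UNIV. (if k = i then a k j else 0) * b k j) = (\<Sum>j\<in>UNIV. a i j * b i j)"
    for a b :: "'a \<Rightarrow> 'b \<Rightarrow> real"
  proof -
    have "(\<Sum>k\<in>UNIV. \<Sum>j\<in>UNIV. (if k = i then a k j else 0) * b k j)
        = (\<Sum>k\<in>UNIV. if k = i then (\<Sum>j\<in>UNIV. a k j * b k j) else 0)"
      by (rule sum.cong) auto
    then show ?thesis by simp
  qed
  show ?thesis
    by (simp add: inner_vec_def sum_index block_def re_part_def im_part_def *)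
qed

lemma block_inner_commute: "block i u \<bullet> v = u \<bullet> block i v"
  using block_inner[of i u v] block_inner[of i v u] by (simp add: inner_commute)

lemma block_inner_block: "block i u \<bullet> block k v = (if i = k then block i u \<bullet> v else 0)"
  using block_inner_commute[of k "block i u" v] by (auto simp: block_block)

lemma weight_block: "weight (block i u) k = 0"
  by (simp add: weight_def block_def)

lemma Nr_iff: "y \<in> Nr \<longleftrightarrow> (\<forall>i. weight y i > 0 \<and> block i y \<bullet> y = 1)"
  by (simp add: Nr_def block_inner norm_prod_def power2_norm_eq_inner)

definition sphere_proj :: "('r::finite, 'n::finite) params \<Rightarrow> ('r, 'n) params \<Rightarrow> ('r, 'n) params" where
  "sphere_proj y u = u - (\<Sum>i\<in>UNIV. (block i y \<bullet> u) *\<^sub>R block i y)"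

text \<open>Combinations of \<open>cos (a t)\<close> and \<open>sin (a t)\<close> with fixed vectors are closed under differentiation, so the great
  circles used below are smooth without any composition rule.\<close>

lemma times_diff_on_trig:
  fixes C D :: "'b::euclidean_space"
  shows "times_diff_on k UNIV (\<lambda>t::real. cos (a * t) *\<^sub>R C + sin (a * t) *\<^sub>R D)"
proof (induction k arbitrary: C D)
  case 0
  then show ?case by (auto intro!: continuous_intros)
next
  case (Suc k)
  show ?case
  proof (rule times_diff_on_SucI)
    show "((\<lambda>t. cos (a * t) *\<^sub>R C + sin (a * t) *\<^sub>R D) has_derivative
        (\<lambda>h. cos (a * t) *\<^sub>R ((a * h) *\<^sub>R D) + sin (a * t) *\<^sub>R (- ((a * h) *\<^sub>R C)))) (at t)" for t
      by (auto intro!: derivative_eq_intros simp: algebra_simps)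
    show "times_diff_on k UNIV
        (\<lambda>t. cos (a * t) *\<^sub>R ((a * h) *\<^sub>R D) + sin (a * t) *\<^sub>R (- ((a * h) *\<^sub>R C)))" for h
      by (rule Suc.IH)
  qed auto
qed

text \<open>A tangent vector is orthogonal to each \<open>block i y\<close> because the functions \<open>z \<mapsto> block i z \<bullet> z\<close> are constant
  on \<^const>\<open>Nr\<close>. Conversely a vector \<open>u\<close> with this property is the velocity of an explicit curve,
  which moves the weights linearly and runs on each sphere along the great circle of speed \<open>norm (block i u)\<close>.\<close>

lemma tangent_space_Nr:
  fixes y :: "('r::finite, 'n::finite) params"
  assumes y: "y \<in> Nr"
  shows "tangent_space Nr y = {u. \<forall>i. block i y \<bullet> u = 0}"
proof (intro equalityI subsetI CollectI allI)
  fix u i assume u: "u \<in> tangent_space Nr y"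
  have h: "((\<lambda>z. block i z \<bullet> z) has_derivative (\<lambda>h. block i y \<bullet> h + block i h \<bullet> y)) (at y)"
    by (intro has_derivative_inner has_derivative_ident bounded_linear_imp_has_derivative bounded_linear_block)
  \<comment> \<open>On \<^const>\<open>Nr\<close> the constant \<open>1\<close> agrees with \<open>z \<mapsto> block i z \<bullet> z\<close>, hence has the same derivative along \<open>u\<close>.\<close>
  have "deriv_along Nr (\<lambda>z. 1) y u = block i y \<bullet> u + block i u \<bullet> y"
    by (rule deriv_along_eq[OF has_derivative_restrict[OF h y] u]) (simp add: Nr_iff)
  moreover have "deriv_along Nr (\<lambda>z. 1::real) y u = 0"
    by (rule deriv_along_eq[OF has_derivative_const u])
  ultimately show "block i y \<bullet> u = 0"
    using block_inner_commute[of i u y] by (simp add: inner_commute)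
next
  fix u assume "u \<in> {u. \<forall>i. block i y \<bullet> u = 0}"
  then have u: "block i y \<bullet> u = 0" for i by simp
  define a where "a i = norm (block i u)" for i
  \<comment> \<open>If \<open>a i = 0\<close> then \<open>b i = 0\<close> and \<open>arc i\<close> stays at \<open>block i y\<close>, so stationary blocks need no special case.\<close>
  define b where "b i = block i u /\<^sub>R a i" for i
  define arc where "arc i t = cos (a i * t) *\<^sub>R block i y + sin (a i * t) *\<^sub>R b i" for i t
  define c where "c t = (y - (\<Sum>i\<in>UNIV. block i y)) + t *\<^sub>R (u - (\<Sum>i\<in>UNIV. block i u))
    + (\<Sum>i\<in>UNIV. arc i t)" for t
  have ab: "a i *\<^sub>R b i = block i u" for i by (cases "block i u = 0") (simp_all add: a_def b_def)
  have block_sum: "block k (\<Sum>i\<in>UNIV. f i) = (\<Sum>i\<in>UNIV. block k (f i))" for k and f :: "'r \<Rightarrow> ('r, 'n) params"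
    by (rule linear_sum[OF linear_block])
  have block_arc: "block k (arc i t) = (if k = i then arc i t else 0)" for k i t
    unfolding arc_def b_def by (simp add: linear_add[OF linear_block] linear_cmul[OF linear_block] block_block)
  have block_c: "block k (c t) = arc k t" for k t
    unfolding c_def linear_add[OF linear_block] linear_diff[OF linear_block] linear_cmul[OF linear_block]
      block_sum block_arc block_block by simp
  have weight_arc: "weight (arc i t) k = 0" for i k t
    using weight_block[of i "arc i t"] block_arc[of i i t] by simp
  have weight_c: "weight (c t) k = weight y k + t * weight u k" for k t
    using weight_arc weight_block[of _ y k] weight_block[of _ u k] by (simp add: c_def weight_def)
  have unit: "block k (c t) \<bullet> c t = 1" for k t
  proof -
    have 1: "block k y \<bullet> block k y = 1" using y by (simp add: block_inner_block Nr_iff)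
    have 2: "block k y \<bullet> b k = 0" using u by (simp add: b_def block_inner_block)
    have 3: "sin (a k * t) * sin (a k * t) * (b k \<bullet> b k) = sin (a k * t) * sin (a k * t)"
      by (cases "a k = 0") (simp_all add: b_def a_def power2_norm_eq_inner[symmetric] power2_eq_square field_simps)
    have "block k (c t) \<bullet> c t = arc k t \<bullet> arc k t"
      using block_inner_block[of k "c t" k "c t"] by (simp add: block_c)
    also have "\<dots> = cos (a k * t) * cos (a k * t) * (block k y \<bullet> block k y)
        + 2 * cos (a k * t) * sin (a k * t) * (block k y \<bullet> b k) + sin (a k * t) * sin (a k * t) * (b k \<bullet> b k)"
      by (simp add: arc_def inner_add_left inner_add_right inner_commute)
    also have "\<dots> = 1" unfolding 1 2 3 by (simp flip: power2_eq_square)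
    finally show ?thesis .
  qed
  have "open (\<Inter>k. {t. 0 < weight y k + t * weight u k})"
    by (intro open_INT ballI open_Collect_less continuous_intros) simp
  moreover have "(\<Inter>k. {t. 0 < weight y k + t * weight u k}) = {t. \<forall>k. 0 < weight y k + t * weight u k}"
    by blast
  ultimately have "open {t. \<forall>k. 0 < weight y k + t * weight u k}" by simp
  moreover have "0 \<in> {t. \<forall>k. 0 < weight y k + t * weight u k}" using y by (simp add: Nr_iff)
  ultimately obtain e where e: "e > 0" "ball 0 e \<subseteq> {t. \<forall>k. 0 < weight y k + t * weight u k}"
    by (rule openE)
  have smooth_arc: "infinitely_diff_on UNIV (arc i)" for i
    unfolding arc_def[abs_def] infinitely_diff_on_def using times_diff_on_trig by blast
  have smooth: "infinitely_diff_on UNIV c"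
    unfolding c_def[abs_def]
    by (intro infinitely_diff_on_add infinitely_diff_on_sum infinitely_diff_on_const smooth_arc
        infinitely_diff_on_scaleR infinitely_diff_on_linear[OF _ bounded_linear_ident] open_UNIV)
  have "(c has_vector_derivative (u - (\<Sum>i\<in>UNIV. block i u)) + (\<Sum>i\<in>UNIV. a i *\<^sub>R b i)) (at 0)"
    unfolding c_def arc_def has_vector_derivative_def
    by (auto intro!: derivative_eq_intros simp: algebra_simps scaleR_sum_right)
  then have deriv: "(c has_vector_derivative u) (at 0)" by (simp add: ab)
  have "smooth_on {-e<..<e} c"
    by (rule smooth_onI[OF open_UNIV subset_UNIV smooth]) simp
  moreover have "c ` {-e<..<e} \<subseteq> Nr"
    using e(2) unit weight_c by (force simp: Nr_iff dist_real_def)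
  moreover have "c 0 = y"
    by (simp add: c_def arc_def)
  ultimately show "u \<in> tangent_space Nr y"
    unfolding tangent_space_def using deriv e(1) by blast
qed

lemma sphere_proj_has_derivative:
  "((\<lambda>z. sphere_proj z v) has_derivative
    (\<lambda>h. - (\<Sum>i\<in>UNIV. (block i h \<bullet> v) *\<^sub>R block i y + (block i y \<bullet> v) *\<^sub>R block i h))) (at y)"
  unfolding sphere_proj_def
  by (rule derivative_eq_intros refl bounded_linear_imp_has_derivative[OF bounded_linear_block])+
    (simp add: add.commute)

lemmas sphere_proj_frechet = frechet_derivative_at[OF sphere_proj_has_derivative, symmetric]

text \<open>For tangent \<open>u\<close> and \<open>v\<close> the derivative formula reduces to \<open>- (\<Sum>i. (block i u \<bullet> v) *\<^sub>R block i y)\<close>, which is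
  symmetric because each \<open>block i\<close> is self-adjoint.\<close>

interpretation Nr: tangential_projection Nr sphere_proj
proof (rule tangential_projection.intro)
  fix y u v :: "('r::finite, 'n::finite) params"
  show "infinitely_diff_on UNIV (\<lambda>z. sphere_proj z u)"
    unfolding sphere_proj_def
    by (intro infinitely_diff_on_diff infinitely_diff_on_sum infinitely_diff_on_const
        infinitely_diff_on_scaleR infinitely_diff_on_inner infinitely_diff_on_linear bounded_linear_block) auto
  show "linear (sphere_proj y)"
    by (rule linearI)
      (simp_all add: sphere_proj_def inner_add_right scaleR_add_left sum.distrib scaleR_sum_right algebra_simps)
  show "sphere_proj y u \<bullet> v = u \<bullet> sphere_proj y v"
    by (simp add: sphere_proj_def inner_diff_left inner_diff_right inner_sum_left inner_sum_right
        inner_commute mult.commute)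
  show "sphere_proj y u \<in> tangent_space Nr y" if "y \<in> Nr"
    using that by (simp add: tangent_space_Nr sphere_proj_def inner_diff_right inner_sum_right
        block_inner_block Nr_iff if_distrib[of "\<lambda>x. _ * x"] cong: if_cong)
  assume u: "u \<in> tangent_space Nr y"
  have y: "y \<in> Nr" using tangent_space_point[OF u] .
  show "sphere_proj y u = u" using u by (simp add: tangent_space_Nr[OF y] sphere_proj_def)
  assume v: "v \<in> tangent_space Nr y"
  have sym: "block i u \<bullet> v = block i v \<bullet> u" for i
    using block_inner_commute[of i u v] by (simp add: inner_commute)
  show "frechet_derivative (\<lambda>z. sphere_proj z v) (at y) u = frechet_derivative (\<lambda>z. sphere_proj z u) (at y) v"
    using u v sym by (simp add: sphere_proj_frechet tangent_space_Nr[OF y])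
qed

lemma correction_mult: "correction s *v u = (\<Sum>i\<in>UNIV. s i *\<^sub>R block i u)"
proof (rule vec_eq_iff[THEN iffD2], rule allI)
  fix a
  have "(correction s *v u) $ a = (\<Sum>b\<in>UNIV. if a = b then
      (case a of Inl i \<Rightarrow> 0 | Inr (Inl (i, j)) \<Rightarrow> s i | Inr (Inr (i, j)) \<Rightarrow> s i) * u $ a else 0)"
    unfolding matrix_vector_mult_def correction_def vec_lambda_beta by (rule sum.cong) auto
  also have "\<dots> = (\<Sum>i\<in>UNIV. s i *\<^sub>R block i u) $ a"
    by (auto simp: block_def if_distrib[of "\<lambda>x. _ * x"] split: sum.split cong: if_cong)
  finally show "(correction s *v u) $ a = (\<Sum>i\<in>UNIV. s i *\<^sub>R block i u) $ a" .
qed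

lemma shift_eq: "shift y g i = - (block i y \<bullet> g)"
  by (simp add: shift_def block_inner)

text \<open>The Weingarten term for \<^const>\<open>Nr\<close>. Of the two sums in the derivative of the projection, the one along the
  normal vectors \<open>block i y\<close> is removed by the outer projection. The other one rescales the block \<open>i\<close> of \<open>u\<close> by
  \<open>- (block i y \<bullet> g)\<close>, and this is the correction matrix.\<close>

lemma sphere_proj_shift:
  assumes "u \<in> tangent_space Nr y"
  shows "sphere_proj y (frechet_derivative (\<lambda>z. sphere_proj z g) (at y) u)
    = sphere_proj y (correction (shift y g) *v u)"
proof -
  have y: "y \<in> Nr" using tangent_space_point[OF assms] .
  have *: "sphere_proj y (block i y) = 0" for i
    using y by (simp add: sphere_proj_def block_inner_block Nr_iff if_distrib[of "\<lambda>x. x *\<^sub>R _"] cong: if_cong)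
  have "frechet_derivative (\<lambda>z. sphere_proj z g) (at y) u
      = - (\<Sum>i\<in>UNIV. (block i u \<bullet> g) *\<^sub>R block i y) + correction (shift y g) *v u"
    by (simp add: sphere_proj_frechet correction_mult shift_eq sum.distrib sum_negf)
  then show ?thesis
    by (simp add: linear_add[OF Nr.linear_P] linear_diff[OF Nr.linear_P] linear_neg[OF Nr.linear_P]
        linear_sum[OF Nr.linear_P] linear_cmul[OF Nr.linear_P] *)
qed

section \<open>Ambient gradient and Hessian\<close>

lemma frechet_derivative_eq_gradient:
  fixes f :: "real ^ 'm::finite \<Rightarrow> real"
  assumes "f differentiable (at z)"
  shows "frechet_derivative f (at z) u = gradient_vector f z \<bullet> u"
proof -
  have lin: "linear (frechet_derivative f (at z))"
    using assms by (rule linear_frechet_derivative)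
  have "frechet_derivative f (at z) (\<Sum>a\<in>UNIV. (u $ a) *\<^sub>R axis a 1)
      = (\<Sum>a\<in>UNIV. u $ a * frechet_derivative f (at z) (axis a 1))"
    by (simp add: linear_sum[OF lin] linear_cmul[OF lin])
  moreover have "(\<Sum>a\<in>UNIV. (u $ a) *\<^sub>R axis a 1) = u"
    using basis_expansion[of u] by (simp add: scalar_mult_eq_scaleR)
  ultimately show ?thesis
    by (simp add: gradient_vector_def partial_deriv_def inner_vec_def mult.commute)
qed

lemma gradient_vector_expansion:
  "gradient_vector f z = (\<Sum>a\<in>UNIV. partial_deriv a f z *\<^sub>R axis a 1)"
  using basis_expansion[of "gradient_vector f z"] by (simp add: scalar_mult_eq_scaleR gradient_vector_def)

lemma
  fixes f :: "real ^ 'm::finite \<Rightarrow> real"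
  assumes "infinitely_diff_on UNIV f"
  shows has_derivative_gradient: "(f has_derivative (\<lambda>u. gradient_vector f z \<bullet> u)) (at z)"
    and infinitely_diff_on_gradient: "infinitely_diff_on UNIV (gradient_vector f)"
    and gradient_has_derivative_hessian:
      "(gradient_vector f has_derivative (\<lambda>u. hessian_matrix f z *v u)) (at z)"
proof -
  have grad: "(h has_derivative (\<lambda>u. gradient_vector h z \<bullet> u)) (at z)"
    if "infinitely_diff_on UNIV h" for h :: "real ^ 'm \<Rightarrow> real" and z
  proof -
    have h: "(h has_derivative frechet_derivative h (at z)) (at z)"
      by (rule infinitely_diff_on_has_derivative[OF open_UNIV that UNIV_I])
    then have "frechet_derivative h (at z) = (\<lambda>u. gradient_vector h z \<bullet> u)"
      using frechet_derivative_eq_gradient differentiable_def by blast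
    with h show ?thesis by simp
  qed
  show "(f has_derivative (\<lambda>u. gradient_vector f z \<bullet> u)) (at z)" by (rule grad[OF assms])
  have partial: "infinitely_diff_on UNIV (partial_deriv a f)" for a
    unfolding partial_deriv_def[abs_def] by (rule infinitely_diff_on_derivative[OF assms])
  show "infinitely_diff_on UNIV (gradient_vector f)"
    unfolding gradient_vector_expansion[abs_def]
    by (intro infinitely_diff_on_sum infinitely_diff_on_scaleR infinitely_diff_on_const partial) auto
  have "(gradient_vector f has_derivative
      (\<lambda>u. \<Sum>a\<in>UNIV. (gradient_vector (partial_deriv a f) z \<bullet> u) *\<^sub>R axis a 1)) (at z)"
    unfolding gradient_vector_expansion[of f, abs_def]
    by (intro has_derivative_sum has_derivative_scaleR_left grad partial)
  moreover have "(\<Sum>a\<in>UNIV. (gradient_vector (partial_deriv a f) z \<bullet> u) *\<^sub>R axis a 1)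
      = hessian_matrix f z *v u" for u
  proof -
    have "gradient_vector (partial_deriv a f) z \<bullet> u = (hessian_matrix f z *v u) $ a" for a
      by (simp add: matrix_vector_mult_def hessian_matrix_def gradient_vector_def inner_vec_def)
    then show ?thesis
      using basis_expansion[of "hessian_matrix f z *v u"] by (simp add: scalar_mult_eq_scaleR)
  qed
  ultimately show "(gradient_vector f has_derivative (\<lambda>u. hessian_matrix f z *v u)) (at z)" by simp
qed

section \<open>Smoothness of the objective function\<close>

text \<open>The finite set of exponents has to be common to all parameters: it turns the convolution product into a
  sum over a fixed finite index set, to which the product rule applies.\<close>

definition smooth_coeffs :: "('a::euclidean_space \<Rightarrow> ('k \<Rightarrow>\<^sub>0 complex)) \<Rightarrow> bool" where
  "smooth_coeffs F \<longleftrightarrow> (\<exists>K. finite K \<and> (\<forall>y. Poly_Mapping.keys (F y) \<subseteq> K)) \<and>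
     (\<forall>\<alpha>. infinitely_diff_on UNIV (\<lambda>y. Poly_Mapping.lookup (F y) \<alpha>))"

lemma smooth_coeffs_const: "smooth_coeffs (\<lambda>y. q)"
  by (auto simp: smooth_coeffs_def infinitely_diff_on_const intro!: exI[of _ "Poly_Mapping.keys q"])

lemma smooth_coeffs_single:
  assumes "infinitely_diff_on UNIV h"
  shows "smooth_coeffs (\<lambda>y. Poly_Mapping.single \<beta> (h y))"
proof -
  have "infinitely_diff_on UNIV (\<lambda>y. Poly_Mapping.lookup (Poly_Mapping.single \<beta> (h y)) \<alpha>)" for \<alpha>
    using assms by (cases "\<alpha> = \<beta>") (simp_all add: lookup_single infinitely_diff_on_const when_def)
  then show ?thesis
    unfolding smooth_coeffs_def by (auto intro!: exI[of _ "{\<beta>}"])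
qed

lemma smooth_coeffs_sum:
  assumes "finite I" "\<And>i. i \<in> I \<Longrightarrow> smooth_coeffs (F i)"
  shows "smooth_coeffs (\<lambda>y. \<Sum>i\<in>I. F i y)"
proof -
  obtain K where K: "\<And>i. i \<in> I \<Longrightarrow> finite (K i)" "\<And>i y. i \<in> I \<Longrightarrow> Poly_Mapping.keys (F i y) \<subseteq> K i"
    using assms(2) unfolding smooth_coeffs_def by metis
  have "Poly_Mapping.keys (\<Sum>i\<in>I. F i y) \<subseteq> (\<Union>i\<in>I. K i)" for y
    using keys_sum[of "\<lambda>i. F i y" I] K(2) by blast
  moreover have "finite (\<Union>i\<in>I. K i)" using assms(1) K(1) by blast
  moreover have "infinitely_diff_on UNIV (\<lambda>y. Poly_Mapping.lookup (\<Sum>i\<in>I. F i y) \<alpha>)" for \<alpha>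
    unfolding lookup_sum using assms(2)
    by (intro infinitely_diff_on_sum) (auto simp: smooth_coeffs_def)
  ultimately show ?thesis unfolding smooth_coeffs_def by blast
qed

lemma poly_mapping_sum_single:
  assumes "finite K" "Poly_Mapping.keys f \<subseteq> K"
  shows "f = (\<Sum>a\<in>K. Poly_Mapping.single a (Poly_Mapping.lookup f a))"
proof (rule poly_mapping_eqI)
  fix k
  show "Poly_Mapping.lookup f k
      = Poly_Mapping.lookup (\<Sum>a\<in>K. Poly_Mapping.single a (Poly_Mapping.lookup f a)) k"
    using assms by (auto simp: lookup_sum lookup_single when_def in_keys_iff)
qed

lemma smooth_coeffs_mult:
  fixes F G :: "'a::euclidean_space \<Rightarrow> ('k::monoid_add \<Rightarrow>\<^sub>0 complex)"
  assumes "smooth_coeffs F" "smooth_coeffs G"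
  shows "smooth_coeffs (\<lambda>y. F y * G y)"
proof -
  obtain K where K: "finite K" "\<And>y. Poly_Mapping.keys (F y) \<subseteq> K"
    using assms(1) unfolding smooth_coeffs_def by blast
  obtain L where L: "finite L" "\<And>y. Poly_Mapping.keys (G y) \<subseteq> L"
    using assms(2) unfolding smooth_coeffs_def by blast
  have "F y * G y = (\<Sum>a\<in>K. \<Sum>b\<in>L. Poly_Mapping.single (a + b)
      (Poly_Mapping.lookup (F y) a * Poly_Mapping.lookup (G y) b))" for y
  proof -
    have "F y * G y = (\<Sum>a\<in>K. Poly_Mapping.single a (Poly_Mapping.lookup (F y) a))
        * (\<Sum>b\<in>L. Poly_Mapping.single b (Poly_Mapping.lookup (G y) b))"
      using poly_mapping_sum_single[OF K] poly_mapping_sum_single[OF L] by metis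
    then show ?thesis by (simp add: sum_product mult_single)
  qed
  moreover have "smooth_coeffs (\<lambda>y. \<Sum>a\<in>K. \<Sum>b\<in>L. Poly_Mapping.single (a + b)
      (Poly_Mapping.lookup (F y) a * Poly_Mapping.lookup (G y) b))"
    using assms K(1) L(1)
    by (intro smooth_coeffs_sum smooth_coeffs_single infinitely_diff_on_mult)
      (auto simp: smooth_coeffs_def)
  ultimately show ?thesis by simp
qed

lemma smooth_coeffs_power:
  fixes F :: "'a::euclidean_space \<Rightarrow> ('k::comm_monoid_add \<Rightarrow>\<^sub>0 complex)"
  assumes "smooth_coeffs F" shows "smooth_coeffs (\<lambda>y. F y ^ d)"
proof (induction d)
  case 0
  show ?case unfolding power_0 by (rule smooth_coeffs_const)
next
  case (Suc d)
  show ?case unfolding power_Suc by (rule smooth_coeffs_mult[OF assms Suc])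
qed

text \<open>The square root in the apolar norm is taken of a weighted sum of squared moduli, so squaring undoes it and
  leaves that sum, a quadratic expression in coefficients that depend polynomially on the parameters.\<close>

lemma infinitely_diff_on_objective:
  fixes p :: "'n::finite cpoly"
  shows "infinitely_diff_on UNIV (objective d p :: ('r::finite, 'n) params \<Rightarrow> real)"
proof -
  define q where "q y = (\<Sum>i\<in>UNIV. cconst (of_real (weight y i)) *
      linear_form (cvec (re_part y i) (im_part y i)) ^ d)" for y :: "('r, 'n) params"
  have coord: "infinitely_diff_on UNIV (\<lambda>y :: ('r, 'n) params. complex_of_real (y $ a))" for a
    using bounded_linear_compose[OF bounded_linear_of_real bounded_linear_vec_nth]
    by (rule infinitely_diff_on_linear[OF open_UNIV])
  have entry: "infinitely_diff_on UNIV (\<lambda>y :: ('r, 'n) params. cvec (re_part y i) (im_part y i) $ j)" for i j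
    unfolding cvec_def re_part_def im_part_def vec_lambda_beta Complex_eq
    by (intro infinitely_diff_on_add infinitely_diff_on_mult infinitely_diff_on_const coord open_UNIV)
  have "smooth_coeffs q"
    unfolding q_def[abs_def] linear_form_def cconst_def weight_def
    by (intro smooth_coeffs_sum smooth_coeffs_mult smooth_coeffs_power smooth_coeffs_single coord entry
        smooth_coeffs_const) auto
  then have coeff: "infinitely_diff_on UNIV (\<lambda>y. scaled_coeff d (q y - p) \<alpha>)" for \<alpha>
    unfolding scaled_coeff_def lookup_minus divide_inverse
    by (intro infinitely_diff_on_mult infinitely_diff_on_diff infinitely_diff_on_const open_UNIV)
      (simp add: smooth_coeffs_def)
  have "objective d p y = 1/2 * (\<Sum>\<alpha>\<in>exponents d. real (multinom d \<alpha>) *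
      (scaled_coeff d (q y - p) \<alpha> \<bullet> scaled_coeff d (q y - p) \<alpha>))" for y
  proof -
    have "Re (apolar d s s) = (\<Sum>\<alpha>\<in>exponents d. real (multinom d \<alpha>) *
        (scaled_coeff d s \<alpha> \<bullet> scaled_coeff d s \<alpha>))" for s :: "'n cpoly"
      unfolding apolar_def Re_sum by (rule sum.cong) (auto simp: inner_complex_def algebra_simps)
    moreover from this have "0 \<le> Re (apolar d s s)" for s :: "'n cpoly"
      by (simp add: sum_nonneg)
    ultimately show ?thesis
      by (simp add: objective_def apolar_norm_def q_def)
  qed
  then have eq: "objective d p = (\<lambda>y. 1/2 * (\<Sum>\<alpha>\<in>exponents d. real (multinom d \<alpha>) *
      (scaled_coeff d (q y - p) \<alpha> \<bullet> scaled_coeff d (q y - p) \<alpha>)))"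
    by blast
  show ?thesis
    unfolding eq
    by (intro infinitely_diff_on_mult infinitely_diff_on_const infinitely_diff_on_sum
        infinitely_diff_on_inner coeff open_UNIV)
qed

section \<open>Coordinates with respect to an orthonormal basis\<close>

lemma orthonormal_columns_transpose_mult:
  assumes "orthonormal_basis_columns Q T"
  shows "transpose Q ** Q = mat 1"
proof -
  have "(transpose Q ** Q) $ k $ l = column k Q \<bullet> column l Q" for k l
    by (simp add: matrix_matrix_mult_def transpose_def column_def inner_vec_def)
  then show ?thesis
    using assms by (simp add: orthonormal_basis_columns_def vec_eq_iff mat_def)
qed

lemma orthonormal_columns_range:
  fixes Q :: "real ^ 'k::finite ^ 'm::finite"
  assumes "orthonormal_basis_columns Q T"
  shows "T = range (\<lambda>x. Q *v x)"
proof -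
  have "columns Q \<subseteq> range (\<lambda>x. Q *v x)"
    by (auto simp: columns_def) (metis matrix_vector_mul_component rangeI matrix_vector_mult_basis)
  moreover have "subspace (range (\<lambda>x. Q *v x))"
    by (rule linear_subspace_image[OF matrix_vector_mul_linear subspace_UNIV])
  ultimately have "span (columns Q) \<subseteq> range (\<lambda>x. Q *v x)" by (rule span_minimal)
  moreover have "range (\<lambda>x. Q *v x) \<subseteq> span (columns Q)"
    using matrix_vector_mult_in_columnspace[of Q] by blast
  ultimately show ?thesis using assms by (auto simp: orthonormal_basis_columns_def)
qed

text \<open>For \<open>Q\<close> with orthonormal columns spanning the tangent space, \<open>Q Q\<^sup>t\<close> is the orthogonal projection: its
  values are tangent, and pairing with \<open>Q x\<close> uses only \<open>Q\<^sup>t Q = 1\<close>.\<close>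

lemma P_eq_mult_transpose:
  fixes Q :: "real ^ 'k::finite ^ 'm::finite"
  assumes "tangential_projection M P" and "y \<in> M" and Q: "orthonormal_basis_columns Q (tangent_space M y)"
  shows "P y w = Q *v (transpose Q *v w)"
proof -
  have "(Q *v (transpose Q *v w)) \<bullet> u = w \<bullet> u" if u: "u \<in> tangent_space M y" for u
  proof -
    obtain x where x: "u = Q *v x" using u orthonormal_columns_range[OF Q] by auto
    have "(Q *v (transpose Q *v w)) \<bullet> u = (transpose Q *v (Q *v (transpose Q *v w))) \<bullet> x"
      unfolding x dot_lmul_matrix[symmetric] transpose_matrix_vector ..
    also have "\<dots> = (transpose Q *v w) \<bullet> x"
      using orthonormal_columns_transpose_mult[OF Q]
      by (simp only: matrix_vector_mul_assoc[of "transpose Q" Q] matrix_vector_mul_lid)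
    also have "\<dots> = w \<bullet> u"
      unfolding x dot_lmul_matrix[symmetric] transpose_matrix_vector ..
    finally show ?thesis .
  qed
  moreover have "Q *v (transpose Q *v w) \<in> tangent_space M y"
    unfolding orthonormal_columns_range[OF Q] by (rule rangeI)
  ultimately show ?thesis
    by (intro tangential_projection.P_eq_iff[OF assms(1,2), THEN iffD2, symmetric] conjI ballI)
qed

theorem proposition4p4:
  fixes d :: nat
    and p :: "'n::finite cpoly"
    and f :: "('r::finite, 'n) params \<Rightarrow> real"
    and y :: "('r, 'n) params"
    and Q :: "real ^ 'k::finite ^ ('r, 'n) index"
    and GR :: "('r, 'n) params"
    and HR S :: "real ^ ('r, 'n) index ^ ('r, 'n) index"
  assumes "d > 2"
    and "CARD('r) < generic_rank d CARD('n)"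
    and "p \<in> homogeneous_polys d"
    and "\<And>z. z \<in> Nr \<Longrightarrow> f z = objective d p z"
    and "y \<in> Nr"
    and "CARD('k) = CARD('r) + (2 * CARD('n) - 1) * CARD('r)"
    and "orthonormal_basis_columns Q (tangent_space Nr y)"
    and "GR = gradient_vector (objective d p) y"
    and "HR = hessian_matrix (objective d p) y"
    and "S = correction (shift y GR)"
  shows "(\<forall>G. riemannian_gradient_wrt Nr f y Q G \<longleftrightarrow> G = transpose Q *v GR) \<and>
         (\<forall>H. riemannian_hessian_wrt Nr f y Q H \<longleftrightarrow> H = transpose Q ** (HR + S) ** Q)"
proof (intro conjI allI)
  note f = \<open>\<And>z. z \<in> Nr \<Longrightarrow> f z = objective d p z\<close> and y = \<open>y \<in> Nr\<close>
    and Q = \<open>orthonormal_basis_columns Q (tangent_space Nr y)\<close>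
  note smooth = infinitely_diff_on_objective[of d p, where ?'r = 'r]
  have P: "sphere_proj y w = Q *v (transpose Q *v w)" for w
    by (rule P_eq_mult_transpose[OF Nr.tangential_projection_axioms y Q])
  have Q_inj: "Q *v a = Q *v b \<longleftrightarrow> a = b" for a b
    using orthonormal_columns_transpose_mult[OF Q]
    by (metis matrix_vector_mul_assoc matrix_vector_mul_lid)
  show "riemannian_gradient_wrt Nr f y Q G \<longleftrightarrow> G = transpose Q *v GR" for G
    using Nr.has_riemannian_gradient_iff[OF has_derivative_gradient[OF smooth] y f, of "Q *v G"]
    by (simp add: riemannian_gradient_wrt_def \<open>GR = _\<close> P Q_inj)
  fix H
  \<comment> \<open>Since \<open>Q\<close> parametrises the tangent space, the Hessian condition becomes a condition on all \<open>Q *v x\<close>.\<close>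
  have hess: "has_riemannian_hessian Nr f y A \<longleftrightarrow>
      (\<forall>x. A (Q *v x) = Q *v (transpose Q ** (HR + S) ** Q *v x))" for A
  proof -
    have "sphere_proj y (frechet_derivative (\<lambda>z. sphere_proj z GR) (at y) u + HR *v u)
        = Q *v (transpose Q *v ((HR + S) *v u))" if "u \<in> tangent_space Nr y" for u
      using sphere_proj_shift[OF that, of GR]
      by (simp only: linear_add[OF Nr.linear_P] \<open>S = _\<close> matrix_vector_mult_add_rdistrib
          P[symmetric] add.commute)
    then have "has_riemannian_hessian Nr f y A \<longleftrightarrow>
        (\<forall>u\<in>tangent_space Nr y. A u = Q *v (transpose Q *v ((HR + S) *v u)))"
      using Nr.has_riemannian_hessian_iff[OF has_derivative_gradient[OF smooth]
          infinitely_diff_on_gradient[OF smooth] gradient_has_derivative_hessian[OF smooth] y f, of A]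
        \<open>GR = _\<close> \<open>HR = _\<close> by simp
    then show ?thesis
      by (simp add: orthonormal_columns_range[OF Q] matrix_vector_mul_assoc matrix_mul_assoc)
  qed
  show "riemannian_hessian_wrt Nr f y Q H \<longleftrightarrow> H = transpose Q ** (HR + S) ** Q"
  proof
    assume "riemannian_hessian_wrt Nr f y Q H"
    then have "Q *v (H *v x) = Q *v (transpose Q ** (HR + S) ** Q *v x)" for x
      unfolding riemannian_hessian_wrt_def hess by metis
    then show "H = transpose Q ** (HR + S) ** Q"
      unfolding Q_inj matrix_eq by blast
  next
    assume H: "H = transpose Q ** (HR + S) ** Q"
    show "riemannian_hessian_wrt Nr f y Q H"
      unfolding riemannian_hessian_wrt_def hess H
      by (rule exI[of _ "\<lambda>u. Q *v (transpose Q *v ((HR + S) *v u))"])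
        (simp add: matrix_vector_mul_assoc matrix_mul_assoc)
  qed
qed

end
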